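(* For $n\ge 1$ let $a_n = |S_n^2(231,312)|$. Then $a_1=1$, $a_2=4$, and $a_{n+1} = 2a_n + 2a_{n-1}$ for all $n\ge 2$.
   Context: A $3$-permutation of size $n$ is an ordered pair $(\sigma,\sigma')$ of permutations of $[n]=\{1,\dots,n\}$. A (classical) permutation $\tau\in S_n$ contains a pattern $\pi\in S_k$ if there are indices $c_1<\dots<c_k$ such that $\tau(c_1)\cdots\tau(c_k)$ is order-isomorphic to $\pi$, and avoids $\pi$ otherwise. A $3$-permutation $(\sigma,\sigma')$ avoids a pattern $\pi\in S_k$ if each of the three permutations $\sigma$, $\sigma'$, and $\sigma'\circ\sigma^{-1}$ (where $(\sigma'\circ\sigma^{-1})(i)=\sigma'(\sigma^{-1}(i))$) avoids $\pi$. $S_n^2(\pi_1,\dots,\pi_m)$ denotes the set of $3$-permutations of size $n$ avoiding each of $\pi_1,\dots,\pi_m$. Patterns are written in one-line notation. *)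

theory Defs
  imports "HOL-Combinatorics.Permutations"
begin

(* A permutation of size n is a function t with "t permutes {1..n}" (hence the identity outside
   {1..n}); a pattern of size k is its one-line notation, a list of length k.
   List positions are numbered from 0, so the indices c_1 < ... < c_k appear as c 0 < ... < c (k-1). *)

definition contains_pattern :: "nat \<Rightarrow> (nat \<Rightarrow> nat) \<Rightarrow> nat list \<Rightarrow> bool" where
  "contains_pattern n t p \<longleftrightarrow>
     (\<exists>c. strict_mono_on {..<length p} c \<and> c ` {..<length p} \<subseteq> {1..n} \<and>
          (\<forall>i<length p. \<forall>j<length p. t (c i) < t (c j) \<longleftrightarrow> p ! i < p ! j))"

definition avoids_pattern :: "nat \<Rightarrow> (nat \<Rightarrow> nat) \<Rightarrow> nat list \<Rightarrow> bool" where
  "avoids_pattern n t p \<longleftrightarrow> \<not> contains_pattern n t p"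

definition three_permutations :: "nat \<Rightarrow> ((nat \<Rightarrow> nat) \<times> (nat \<Rightarrow> nat)) set" where
  "three_permutations n = {s. s permutes {1..n}} \<times> {s'. s' permutes {1..n}}"

definition avoids_pattern3 :: "nat \<Rightarrow> (nat \<Rightarrow> nat) \<times> (nat \<Rightarrow> nat) \<Rightarrow> nat list \<Rightarrow> bool" where
  "avoids_pattern3 n = (\<lambda>(s, s') p.
     avoids_pattern n s p \<and> avoids_pattern n s' p \<and> avoids_pattern n (s' \<circ> inv s) p)"

definition avoiders3 :: "nat \<Rightarrow> nat list set \<Rightarrow> ((nat \<Rightarrow> nat) \<times> (nat \<Rightarrow> nat)) set" where
  "avoiders3 n P = {x \<in> three_permutations n. \<forall>p\<in>P. avoids_pattern3 n x p}"

end

theory Submission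
  imports Defs
begin

text \<open>
  The permutations avoiding 231 and 312 are the layered ones: they reverse each block of a partition
  of \<open>{1..n}\<close> into intervals, and so correspond to the set \<open>G\<close> of those \<open>i < n\<close> for which \<open>i\<close> and
  \<open>i + 1\<close> share a block. They are involutions. For layered permutations with sets \<open>G\<close> and \<open>G'\<close> the
  product is layered iff overlapping blocks of size at least two coincide. Labelling each \<open>i < n\<close> by
  the truth values of \<open>i \<in> G\<close> and \<open>i \<in> G'\<close>, this says that two distinct labels other than
  (False, False) are never adjacent. Counting such words by their last letter gives the recurrence.
\<close>

section \<open>Patterns of length three as inequalities between values\<close>

lemma contains_pattern_3:
  "contains_pattern n t [x, y, z] \<longleftrightarrow>
     (\<exists>a b c. 1 \<le> a \<and> a < b \<and> b < c \<and> c \<le> n \<and>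
       (t a < t b \<longleftrightarrow> x < y) \<and> (t b < t a \<longleftrightarrow> y < x) \<and> (t a < t c \<longleftrightarrow> x < z) \<and>
       (t c < t a \<longleftrightarrow> z < x) \<and> (t b < t c \<longleftrightarrow> y < z) \<and> (t c < t b \<longleftrightarrow> z < y))"
  (is "_ \<longleftrightarrow> ?R")
proof -
  have less3: "{..<length [x, y, z]} = {0, 1, 2}"
    by auto
  have all3: "(\<forall>i<length [x, y, z]. P i) \<longleftrightarrow> P 0 \<and> P 1 \<and> P 2" for P
    by (auto simp: less_Suc_eq numeral_2_eq_2)
  show ?thesis
  proof
    assume "contains_pattern n t [x, y, z]"
    then obtain c where mono: "strict_mono_on {0, 1, 2} c" and c: "c ` {0, 1, 2} \<subseteq> {1..n}"
      and iso: "\<forall>i<length [x, y, z]. \<forall>j<length [x, y, z]. t (c i) < t (c j) \<longleftrightarrow> [x, y, z] ! i < [x, y, z] ! j"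
      unfolding contains_pattern_def less3 by blast
    have "c 0 < c 1" "c 1 < c 2"
      using mono by (auto simp: strict_mono_on_def)
    then show ?R
      using c iso[unfolded all3]
      by (intro exI[of _ "c 0"] exI[of _ "c 1"] exI[of _ "c 2"]) simp
  next
    assume ?R
    then obtain a b c where *: "1 \<le> a" "a < b" "b < c" "c \<le> n"
       "t a < t b \<longleftrightarrow> x < y" "t b < t a \<longleftrightarrow> y < x" "t a < t c \<longleftrightarrow> x < z"
       "t c < t a \<longleftrightarrow> z < x" "t b < t c \<longleftrightarrow> y < z" "t c < t b \<longleftrightarrow> z < y"
      by blast
    then show "contains_pattern n t [x, y, z]"
      unfolding contains_pattern_def less3 all3
      by (intro exI[of _ "\<lambda>i. [a, b, c] ! i"]) (auto simp: strict_mono_on_def)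
  qed
qed

lemma avoids_231:
  "avoids_pattern n t [2, 3, 1] \<longleftrightarrow>
     \<not> (\<exists>a b c. 1 \<le> a \<and> a < b \<and> b < c \<and> c \<le> n \<and> t c < t a \<and> t a < t b)"
  unfolding avoids_pattern_def contains_pattern_3
  by (intro arg_cong[where f = Not] ex_cong1) auto

lemma avoids_312:
  "avoids_pattern n t [3, 1, 2] \<longleftrightarrow>
     \<not> (\<exists>a b c. 1 \<le> a \<and> a < b \<and> b < c \<and> c \<le> n \<and> t b < t c \<and> t c < t a)"
  unfolding avoids_pattern_def contains_pattern_3
  by (intro arg_cong[where f = Not] ex_cong1) auto

section \<open>Layered permutations\<close>

text \<open>
  A local form of layeredness: at each \<open>i\<close> either \<open>t\<close> steps down by one within a block, or a block
  ends and \<open>t\<close> preserves \<open>{..i}\<close>.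
\<close>

definition layered :: "(nat \<Rightarrow> nat) \<Rightarrow> bool" where
  "layered t \<longleftrightarrow> (\<forall>i. t i = Suc (t (Suc i)) \<or> (\<forall>j. t j \<le> i \<longleftrightarrow> j \<le> i))"

lemma layeredD:
  assumes "layered t" "t i \<noteq> Suc (t (Suc i))"
  shows "t j \<le> i \<longleftrightarrow> j \<le> i"
  using assms unfolding layered_def by blast

lemma permutes_le_iff:
  fixes t :: "nat \<Rightarrow> nat"
  assumes "t permutes {1..n}" and "n \<le> i"
  shows "t j \<le> i \<longleftrightarrow> j \<le> i"
proof (cases "j \<in> {1..n}")
  case True
  then have "t j \<in> {1..n}" using permutes_in_image[OF assms(1)] by blast
  then show ?thesis using True assms(2) by auto
next
  case False
  then show ?thesis using assms(1) by (simp add: permutes_not_in)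
qed

text \<open>Consecutive positions decide: an ascent at \<open>i\<close> forces \<open>t\<close> to
  preserve \<open>{..i}\<close>, and a descent by more than one skips a value whose position
  completes a 231 or a 312.\<close>

lemma avoids_imp_layered:
  assumes t: "t permutes {1..n}"
    and "avoids_pattern n t [2, 3, 1]" and "avoids_pattern n t [3, 1, 2]"
  shows "layered t"
  unfolding layered_def
proof (intro allI)
  fix i
  have no231: False if "1 \<le> a" "a < b" "b < c" "c \<le> n" "t c < t a" "t a < t b" for a b c
    using assms(2) that unfolding avoids_231 by blast
  have no312: False if "1 \<le> a" "a < b" "b < c" "c \<le> n" "t b < t c" "t c < t a" for a b c
    using assms(3) that unfolding avoids_312 by blast
  have inj: "inj t" using t by (rule permutes_inj)
  have rng: "t j \<in> {1..n} \<longleftrightarrow> j \<in> {1..n}" for j using t by (rule permutes_in_image)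
  have t0: "t 0 = 0" using t by (simp add: permutes_not_in)
  consider "i = 0" | "n \<le> i" | "1 \<le> i" "i < n" by linarith
  then show "t i = Suc (t (Suc i)) \<or> (\<forall>j. t j \<le> i \<longleftrightarrow> j \<le> i)"
  proof cases
    case 1
    have "t j = 0 \<longleftrightarrow> j = 0" for j using inj t0 by (metis injD)
    then show ?thesis using 1 by simp
  next
    case 2
    then show ?thesis by (intro disjI2 allI permutes_le_iff[OF t])
  next
    case 3
    show ?thesis
    proof (cases "t i < t (Suc i)")
      case True
      \<comment> \<open>Suppose \<open>t b < t a\<close> across the ascent at \<open>i\<close>. If
        \<open>t a \<le> t i\<close>, then \<open>i\<close>, \<open>Suc i\<close>, \<open>b\<close>
        form a 231. Otherwise avoiding 312 at \<open>a\<close>, \<open>i\<close>,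
        \<open>Suc i\<close> puts \<open>t a\<close> below \<open>t (Suc i)\<close>, and
        \<open>a\<close>, \<open>Suc i\<close>, \<open>b\<close> form a 231.\<close>
      have lt: "t a < t b" if "1 \<le> a" "a \<le> i" "i < b" "b \<le> n" for a b
      proof (rule ccontr)
        assume "\<not> t a < t b"
        moreover have "t a \<noteq> t b" using that by (simp add: inj_eq[OF inj])
        ultimately have ba: "t b < t a" by simp
        show False
        proof (cases "t a \<le> t i")
          case le: True
          then have "b \<noteq> Suc i" using ba True by auto
          then have "Suc i < b" using that by simp
          then show False using no231[of i "Suc i" b] 3 that ba le True by auto
        next
          case False
          then have "a \<noteq> i" by auto
          then have ai: "a < i" using that by simp
          have "t a \<noteq> t (Suc i)" using ai by (simp add: inj_eq[OF inj])
          moreover have "\<not> t (Suc i) < t a" using no312[of a i "Suc i"] ai that 3 True by auto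
          ultimately have lt: "t a < t (Suc i)" by simp
          then have "b \<noteq> Suc i" using ba by auto
          then show False using no231[of a "Suc i" b] that ai ba lt by auto
        qed
      qed
      \<comment> \<open>By \<open>lt\<close> the image is downward closed among the positive values,
        and it has \<open>i\<close> elements.\<close>
      have "t ` {1..i} = {1..i}"
      proof -
        let ?S = "t ` {1..i}"
        have fin: "finite ?S" and cS: "card ?S = i"
          using inj by (auto simp: card_image inj_on_subset)
        have down: "v \<in> ?S" if v: "1 \<le> v" "v \<le> w" and w: "w \<in> ?S" for v w
        proof -
          obtain a where a: "a \<in> {1..i}" "w = t a" using w by auto
          then have "w \<le> n" using rng[of a] 3 by auto
          then have "v \<in> t ` {1..n}" using v permutes_image[OF t] by auto
          then obtain b where b: "b \<in> {1..n}" "v = t b" by auto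
          have "b \<le> i" using lt[of a b] a b v by (cases "b \<le> i") auto
          then show ?thesis using b by auto
        qed
        have "?S \<subseteq> {1..i}"
        proof
          fix w assume w: "w \<in> ?S"
          then have "{1..w} \<subseteq> ?S" using down by auto
          then have "card {1..w} \<le> card ?S" using fin by (rule card_mono[rotated])
          moreover have "1 \<le> w" using w rng 3 by fastforce
          ultimately show "w \<in> {1..i}" using cS by simp
        qed
        then show ?thesis using cS by (intro card_subset_eq) auto
      qed
      then have 4: "t j \<in> {1..i} \<longleftrightarrow> j \<in> {1..i}" for j
        using inj by (metis inj_image_mem_iff)
      have 0: "t j = 0 \<longleftrightarrow> j = 0" for j using inj t0 by (metis injD)
      have "t j \<le> i \<longleftrightarrow> j \<le> i" for j using 4[of j] 0[of j] unfolding atLeastAtMost_iff by arith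
      then show ?thesis by blast
    next
      case False
      have "t i \<noteq> t (Suc i)" by (simp add: inj_eq[OF inj])
      then have gt: "t (Suc i) < t i" using False by simp
      have "t i = Suc (t (Suc i))"
      proof (rule ccontr)
        assume neq: "t i \<noteq> Suc (t (Suc i))"
        \<comment> \<open>\<open>v\<close> is a skipped value. Its position \<open>k\<close> gives a
          231 with \<open>i\<close> and \<open>Suc i\<close> if it lies to their left, and a 312 if
          it lies to their right.\<close>
        define v where "v = Suc (t (Suc i))"
        have v: "t (Suc i) < v" "v < t i" using gt neq by (auto simp: v_def)
        have "t i \<in> {1..n}" using rng 3 by simp
        then have "v \<in> t ` {1..n}" using v permutes_image[OF t] by auto
        then obtain k where k: "k \<in> {1..n}" "t k = v" by auto
        then have "k \<noteq> i" "k \<noteq> Suc i" using v by auto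
        then consider "k < i" | "Suc i < k" by linarith
        then show False
          using no231[of k i "Suc i"] no312[of i "Suc i" k] k v 3 by cases auto
      qed
      then show ?thesis by blast
    qed
  qed
qed

lemma layered_decreasing:
  assumes "layered t" "\<And>i. a \<le> i \<Longrightarrow> i < b \<Longrightarrow> \<not> (\<forall>j. t j \<le> i \<longleftrightarrow> j \<le> i)"
  shows "a \<le> b \<Longrightarrow> t a = t b + (b - a)"
  using assms(2)
proof (induction b)
  case (Suc b)
  show ?case
  proof (cases "a \<le> b")
    case True
    have "t b = Suc (t (Suc b))"
      using assms(1) Suc.prems(2)[of b] True unfolding layered_def by blast
    moreover have "t a = t b + (b - a)" using Suc True by simp
    ultimately show ?thesis using True by simp
  next
    case False
    then show ?thesis using Suc.prems by (simp add: not_less_eq_eq le_Suc_eq)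
  qed
qed auto

text \<open>A cut \<open>i\<close> with \<open>a \<le> i < c\<close> would give
  \<open>t a \<le> i < t c\<close>, so an inversion forces unit descents all the way from
  \<open>a\<close> to \<open>c\<close>. This excludes 231 and 312, where the middle position breaks
  the descent.\<close>

lemma layered_interval:
  assumes "layered t" "a \<le> b" "b \<le> c" "t c < t a"
  shows "t a = t b + (b - a)" "t b = t c + (c - b)"
proof -
  have nocut: "\<not> (\<forall>j. t j \<le> i \<longleftrightarrow> j \<le> i)" if "a \<le> i" "i < c" for i
    using that assms(4) by (meson leD le_trans less_imp_le not_less)
  show "t a = t b + (b - a)"
    by (rule layered_decreasing[OF assms(1) nocut]) (use assms(2,3) in auto)
  show "t b = t c + (c - b)"
    by (rule layered_decreasing[OF assms(1) nocut]) (use assms(2,3) in auto)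
qed

lemma avoids_iff_layered:
  assumes "t permutes {1..n}"
  shows "avoids_pattern n t [2, 3, 1] \<and> avoids_pattern n t [3, 1, 2] \<longleftrightarrow> layered t"
proof
  assume "layered t"
  have "\<not> (t c < t a \<and> t a < t b)" "\<not> (t b < t c \<and> t c < t a)" if "a < b" "b < c" for a b c
    using layered_interval[OF \<open>layered t\<close>, of a b c] that by auto
  then show "avoids_pattern n t [2, 3, 1] \<and> avoids_pattern n t [3, 1, 2]"
    unfolding avoids_231 avoids_312 by blast
qed (use avoids_imp_layered[OF assms] in blast)

section \<open>Layered permutations as block reversals\<close>

text \<open>A maximal run of positions joined by \<open>G\<close>, possibly a single point. Writing
  the left end as \<open>Suc k = l\<close> makes that condition vacuous at \<open>l = 0\<close> and
  avoids truncated subtraction.\<close>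

definition block :: "nat set \<Rightarrow> nat \<Rightarrow> nat \<Rightarrow> bool" where
  "block G l h \<longleftrightarrow> l \<le> h \<and> {l..<h} \<subseteq> G \<and> h \<notin> G \<and> (\<forall>k. Suc k = l \<longrightarrow> k \<notin> G)"

text \<open>For finite \<open>G\<close> the two \<open>LEAST\<close> terms are the ends of the block
  containing \<open>i\<close>, and the value is the reflection of \<open>i\<close> in that
  block.\<close>

definition block_reversal :: "nat set \<Rightarrow> nat \<Rightarrow> nat" where
  "block_reversal G i = (LEAST l. {l..<i} \<subseteq> G) + (LEAST h. i \<le> h \<and> h \<notin> G) - i"

lemma block_reversal_eq:
  assumes "block G l h" "l \<le> i" "i \<le> h"
  shows "block_reversal G i = l + h - i"
proof -
  have "(LEAST l. {l..<i} \<subseteq> G) = l"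
  proof (rule Least_equality)
    show "{l..<i} \<subseteq> G" using assms unfolding block_def by auto
    show "l \<le> y" if "{y..<i} \<subseteq> G" for y
    proof (rule ccontr)
      assume "\<not> l \<le> y"
      then have "l - 1 \<in> {y..<i}" "Suc (l - 1) = l" using assms by auto
      then show False using that assms(1) unfolding block_def by blast
    qed
  qed
  moreover have "(LEAST h. i \<le> h \<and> h \<notin> G) = h"
  proof (rule Least_equality)
    show "i \<le> h \<and> h \<notin> G" using assms unfolding block_def by auto
    show "h \<le> y" if "i \<le> y \<and> y \<notin> G" for y
      using that assms unfolding block_def by (metis atLeastLessThan_iff le_trans not_less subsetD)
  qed
  ultimately show ?thesis unfolding block_reversal_def by simp
qed

lemma ex_block:
  assumes "finite G"
  obtains l h where "block G l h" "l \<le> i" "i \<le> h"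
proof -
  define l where "l = (LEAST l. {l..<i} \<subseteq> G)"
  define h where "h = (LEAST h. i \<le> h \<and> h \<notin> G)"
  have l: "{l..<i} \<subseteq> G" unfolding l_def by (rule LeastI[of _ i]) simp
  have li: "l \<le> i" unfolding l_def by (rule Least_le) simp
  have "infinite ({i..} - G)" using assms infinite_Ici by (rule Diff_infinite_finite)
  then have "{i..} - G \<noteq> {}" by (metis finite.emptyI)
  then obtain h0 where "i \<le> h0 \<and> h0 \<notin> G" by auto
  then have h: "i \<le> h \<and> h \<notin> G" unfolding h_def by (rule LeastI)
  have below: "k \<in> G" if "i \<le> k" "k < h" for k
    using not_less_Least[of k "\<lambda>h. i \<le> h \<and> h \<notin> G"] that unfolding h_def by blast
  have "k \<notin> G" if "Suc k = l" for k
  proof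
    assume "k \<in> G"
    then have "{k..<i} \<subseteq> G"
      using l that by (metis atLeastLessThan_iff le_eq_less_or_eq Suc_leI subsetD subsetI)
    then have "l \<le> k" unfolding l_def by (rule Least_le)
    then show False using that by simp
  qed
  then have "block G l h"
    using l li h below unfolding block_def by (auto simp: subset_iff) (metis not_le)
  then show thesis using that li h by blast
qed

lemma block_reversal_fixpoint:
  assumes "i \<notin> G" "\<And>k. Suc k = i \<Longrightarrow> k \<notin> G"
  shows "block_reversal G i = i"
  using block_reversal_eq[of G i i i] assms unfolding block_def by auto

lemma block_reversal_involution:
  assumes "finite G"
  shows "block_reversal G (block_reversal G i) = i"
proof -
  obtain l h where "block G l h" "l \<le> i" "i \<le> h" using ex_block[OF assms] .
  then show ?thesis using block_reversal_eq[of G l h] by simp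
qed

lemma inj_block_reversal: "finite G \<Longrightarrow> inj (block_reversal G)"
  by (metis block_reversal_involution injI)

lemma inv_block_reversal:
  assumes "finite G"
  shows "inv (block_reversal G) = block_reversal G"
  by (rule inv_unique_comp) (use assms in \<open>auto simp: block_reversal_involution\<close>)

lemma block_reversal_step:
  assumes "finite G" "i \<in> G"
  shows "block_reversal G i = Suc (block_reversal G (Suc i))"
proof -
  obtain l h where lh: "block G l h" "l \<le> i" "i \<le> h" using ex_block[OF assms(1)] .
  then have "i < h" using assms(2) unfolding block_def by (metis le_neq_implies_less)
  then show ?thesis using block_reversal_eq[OF lh(1)] lh by simp
qed

text \<open>The block of \<open>j\<close> cannot contain both \<open>i\<close> and
  \<open>Suc i\<close>, so reversing it keeps \<open>j\<close> on its side of the cut.\<close>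

lemma block_reversal_cut:
  assumes "finite G" "i \<notin> G"
  shows "block_reversal G j \<le> i \<longleftrightarrow> j \<le> i"
proof -
  obtain l h where lh: "block G l h" "l \<le> j" "j \<le> h" using ex_block[OF assms(1)] .
  have "\<not> (l \<le> i \<and> i < h)" using assms(2) lh(1) unfolding block_def by auto
  then show ?thesis using block_reversal_eq[OF lh] lh by auto
qed

lemma layered_block_reversal: "finite G \<Longrightarrow> layered (block_reversal G)"
  unfolding layered_def using block_reversal_step block_reversal_cut by blast

text \<open>Recovers \<open>G\<close> from its permutation, which makes the encoding injective. For
  \<open>i \<notin> G\<close> the cut puts the value at \<open>i\<close> below the value at
  \<open>Suc i\<close>, so there is no descent.\<close>

lemma mem_iff_block_reversal_step:
  assumes "finite G"
  shows "i \<in> G \<longleftrightarrow> block_reversal G i = Suc (block_reversal G (Suc i))"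
  using block_reversal_step[OF assms, of i] block_reversal_cut[OF assms, of i i]
    block_reversal_cut[OF assms, of i "Suc i"] by fastforce

lemma block_reversal_permutes:
  assumes "G \<subseteq> {1..<n}"
  shows "block_reversal G permutes {1..n}"
proof -
  have fin: "finite G" using assms finite_subset by blast
  have "block_reversal G i = i" if "i \<notin> {1..n}" for i
    by (rule block_reversal_fixpoint) (use that assms in auto)
  then show ?thesis
    unfolding permutes_def by (metis block_reversal_involution[OF fin])
qed

lemma layered_imp_block_reversal:
  assumes t: "t permutes {1..n}" and lay: "layered t"
  obtains G where "G \<subseteq> {1..<n}" "t = block_reversal G"
proof -
  \<comment> \<open>The unit descents are the places inside blocks; by layeredness every other
    \<open>i\<close> is a cut.\<close>
  define G where "G = {i. t i = Suc (t (Suc i))}"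
  have cut: "t j \<le> i \<longleftrightarrow> j \<le> i" if "i \<notin> G" for i j
    using layeredD[OF lay, of i j] that unfolding G_def by blast
  have t0: "t 0 = 0" using t by (simp add: permutes_not_in)
  have "i \<in> {1..<n}" if "i \<in> G" for i
  proof (rule ccontr)
    assume "i \<notin> {1..<n}"
    then consider "i = 0" | "n \<le> i" by fastforce
    then show False
    proof cases
      case 1
      then show False using that t0 unfolding G_def by simp
    next
      case 2
      then show False
        using permutes_le_iff[OF t, of i i] permutes_le_iff[OF t, of i "Suc i"] that
        unfolding G_def by simp
    qed
  qed
  then have sub: "G \<subseteq> {1..<n}" by blast
  then have fin: "finite G" using finite_subset by blast
  have "t i = block_reversal G i" for i
  proof -
    obtain l h where lh: "block G l h" "l \<le> i" "i \<le> h" using ex_block[OF fin] .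
    have desc: "t l = t (l + k) + k" if "l + k \<le> h" for k
      using that
    proof (induction k)
      case (Suc k)
      then have "l + k \<in> G" using lh(1) unfolding block_def by auto
      then show ?case using Suc unfolding G_def by simp
    qed simp
    \<comment> \<open>The drop from \<open>t l\<close> to \<open>t h\<close> is
      \<open>h - l\<close>, while the cuts at \<open>h\<close> and just before \<open>l\<close> give
      \<open>t l \<le> h\<close> and \<open>l \<le> t h\<close>. This leaves only
      \<open>t l = h\<close>.\<close>
    have "t l = t h + (h - l)" using desc[of "h - l"] lh by simp
    moreover have "t l \<le> h" using cut[of h l] lh unfolding block_def by blast
    moreover have "l \<le> t h"
      using cut[of "l - 1" h] lh unfolding block_def by (cases l) auto
    ultimately have "t l = h" using lh by simp
    then have "t i = l + h - i" using desc[of "i - l"] lh by simp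
    then show ?thesis using block_reversal_eq[OF lh] by simp
  qed
  then show thesis using that sub by blast
qed

section \<open>Products of block reversals\<close>

text \<open>
  With \<open>s i = x + 1\<close> and \<open>s (i + 1) = x\<close>, the product decreases at \<open>i\<close>, hence by exactly one, which
  forces \<open>x\<close> and \<open>x + 1\<close> to be fixed points of \<open>s'\<close>.
\<close>

lemma layered_comp_imp_isolated:
  assumes fin: "finite G" "finite G'"
    and lay: "layered (block_reversal G' \<circ> block_reversal G)"
    and x: "x \<in> G" "x \<notin> G'"
  shows "Suc x \<notin> G'" and "\<And>y. Suc y = x \<Longrightarrow> y \<notin> G'"
proof -
  let ?s = "block_reversal G" and ?s' = "block_reversal G'"
  define i where "i = ?s (Suc x)"
  have i: "?s i = Suc x" "?s (Suc i) = x"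
    using block_reversal_step[OF fin(1) x(1)] unfolding i_def
    by (metis block_reversal_involution[OF fin(1)])+
  have le: "?s' x \<le> x" and gt: "x < ?s' (Suc x)"
    using block_reversal_cut[OF fin(2) x(2), of x] block_reversal_cut[OF fin(2) x(2), of "Suc x"]
    by auto
  \<comment> \<open>A cut of the product at \<open>i\<close> would make it ascend there, but
    \<open>le\<close> and \<open>gt\<close> show that it descends. The drop is therefore one, and
    the same bounds then fix \<open>x\<close> and \<open>Suc x\<close>.\<close>
  have "?s' (?s i) = Suc (?s' (?s (Suc i)))"
    using layeredD[OF lay, of i i] layeredD[OF lay, of i "Suc i"] i le gt by fastforce
  then have fixed: "?s' x = x" "?s' (Suc x) = Suc x"
    using i le gt by auto
  note inj = injD[OF inj_block_reversal[OF fin(2)]]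
  show "Suc x \<notin> G'"
  proof
    assume "Suc x \<in> G'"
    \<comment> \<open>Another unit descent would send \<open>Suc (Suc x)\<close> to
      \<open>x\<close>, a value already taken at \<open>x\<close>.\<close>
    then have "?s' (Suc (Suc x)) = ?s' x" using block_reversal_step[OF fin(2)] fixed by fastforce
    then show False using inj by fastforce
  qed
  show "y \<notin> G'" if "Suc y = x" for y
  proof
    assume "y \<in> G'"
    then have "?s' y = ?s' (Suc x)" using block_reversal_step[OF fin(2)] fixed that by fastforce
    then show False using inj that by fastforce
  qed
qed

text \<open>The blank letter \<open>(False, False)\<close> marks a common cut of both
  permutations.\<close>

definition compatible :: "bool \<times> bool \<Rightarrow> bool \<times> bool \<Rightarrow> bool" where
  "compatible c d \<longleftrightarrow> c = d \<or> c = (False, False) \<or> d = (False, False)"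

text \<open>On a block of \<open>G \<union> G'\<close> the label is constant up to the right end, so
  each factor either reverses the whole block or fixes it pointwise. The product then reverses the
  block or is the identity on it.\<close>

lemma compatible_imp_layered_comp:
  assumes fin: "finite G" "finite G'"
    and comp: "\<And>x. compatible (x \<in> G, x \<in> G') (Suc x \<in> G, Suc x \<in> G')"
  shows "layered (block_reversal G' \<circ> block_reversal G)"
  unfolding layered_def
proof (intro allI)
  fix i
  let ?s = "block_reversal G" and ?s' = "block_reversal G'"
  let ?t = "?s' \<circ> ?s"
  have cut: "?t j \<le> k \<longleftrightarrow> j \<le> k" if "k \<notin> G \<union> G'" for k j
    using block_reversal_cut[OF fin(1)] block_reversal_cut[OF fin(2)] that by simp
  show "?t i = Suc (?t (Suc i)) \<or> (\<forall>j. ?t j \<le> i \<longleftrightarrow> j \<le> i)"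
  proof (cases "i \<in> G \<union> G'")
    case False
    then show ?thesis using cut by blast
  next
    case True
    have "finite (G \<union> G')" using fin by simp
    then obtain l h where lh: "block (G \<union> G') l h" "l \<le> i" "i \<le> h" by (rule ex_block)
    have "i < h" using lh True unfolding block_def by (metis le_neq_implies_less)
    have run: "k \<in> G \<union> G'" if "l \<le> k" "k < h" for k
      using lh(1) that unfolding block_def by (meson atLeastLessThan_iff subsetD)
    have const0: "(k \<in> G \<longleftrightarrow> l \<in> G) \<and> (k \<in> G' \<longleftrightarrow> l \<in> G')" if "l \<le> k" "k < h" for k
      using that
    proof (induction rule: dec_induct)
      case (step k)
      have "k \<in> G \<union> G'" "Suc k \<in> G \<union> G'" using run[of k] run[of "Suc k"] step by auto
      then show ?case using comp[of k] step unfolding compatible_def by auto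
    qed simp
    have const: "(k \<in> G \<longleftrightarrow> i \<in> G) \<and> (k \<in> G' \<longleftrightarrow> i \<in> G')" if "l \<le> k" "k < h" for k
      using const0[OF that] const0[of i] lh \<open>i < h\<close> by blast
    have ends: "h \<notin> G \<union> G'" "\<And>k. Suc k = l \<Longrightarrow> k \<notin> G \<union> G'"
      using lh(1) unfolding block_def by auto
    \<comment> \<open>\<open>H\<close> stands for \<open>G\<close> or \<open>G'\<close>. If
      \<open>i \<notin> H\<close>, then \<open>H\<close> contains no element from just before
      \<open>l\<close> up to \<open>h\<close>, so every point of the block is a block of its own for
      \<open>H\<close>.\<close>
    have on_block: "block_reversal H j = (if i \<in> H then l + h - j else j)"
      if H: "H \<subseteq> G \<union> G'" "\<And>k. l \<le> k \<Longrightarrow> k < h \<Longrightarrow> k \<in> H \<longleftrightarrow> i \<in> H" and j: "l \<le> j" "j \<le> h" for H j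
    proof (cases "i \<in> H")
      case True
      then have "block H l h" using H lh(1) unfolding block_def by auto
      then show ?thesis using block_reversal_eq j True by simp
    next
      case False
      have "k \<notin> H" if "l \<le> Suc k" "k \<le> h" for k
        using that H ends False by (metis le_SucE le_neq_implies_less subsetD)
      then have "block_reversal H j = j"
        using j by (intro block_reversal_fixpoint) auto
      then show ?thesis using False by simp
    qed
    have s: "?s j = (if i \<in> G then l + h - j else j)" if "l \<le> j" "j \<le> h" for j
      by (rule on_block) (use that const in auto)
    have s': "?s' j = (if i \<in> G' then l + h - j else j)" if "l \<le> j" "j \<le> h" for j
      by (rule on_block) (use that const in auto)
    show ?thesis
    proof (cases "i \<in> G \<and> i \<in> G'")
      case False
      then have "?t i = Suc (?t (Suc i))"
        using s s' True lh \<open>i < h\<close> by auto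
      then show ?thesis ..
    next
      case both: True
      \<comment> \<open>Two reversals cancel on the block, and the common cuts at its ends keep all
        other points on their side, so \<open>i\<close> is a cut of the product.\<close>
      have "?t j \<le> i \<longleftrightarrow> j \<le> i" for j
      proof -
        consider "l \<le> j" "j \<le> h" | "j < l" | "h < j" by linarith
        then show ?thesis
        proof cases
          case 1
          then show ?thesis using s s' both by simp
        next
          case 2
          then have "?t j \<le> l - 1" using cut[of "l - 1" j] ends(2)[of "l - 1"] by simp
          then show ?thesis using 2 lh by simp
        next
          case 3
          then have "\<not> ?t j \<le> h" using cut[OF ends(1)] by simp
          then show ?thesis using 3 lh by simp
        qed
      qed
      then show ?thesis by blast
    qed
  qed
qed

text \<open>The product is layered, hence an involution, so the two involutions commute. The
  isolation lemma therefore applies with the roles of \<open>G\<close> and \<open>G'\<close>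
  exchanged as well.\<close>

lemma layered_comp_imp_compatible:
  assumes G: "G \<subseteq> {1..<n}" and G': "G' \<subseteq> {1..<n}"
    and lay: "layered (block_reversal G' \<circ> block_reversal G)"
  shows "compatible (x \<in> G, x \<in> G') (Suc x \<in> G, Suc x \<in> G')"
proof -
  let ?s = "block_reversal G" and ?s' = "block_reversal G'"
  have fin: "finite G" "finite G'" using G G' finite_subset by blast+
  have "?s' \<circ> ?s permutes {1..n}"
    using G G' by (intro permutes_compose block_reversal_permutes)
  then obtain H where H: "H \<subseteq> {1..<n}" "?s' \<circ> ?s = block_reversal H"
    using lay layered_imp_block_reversal by blast
  then have "finite H" using finite_subset by blast
  have "(?s' \<circ> ?s) (?s (?s' i)) = i" for i
    using fin by (simp add: block_reversal_involution)
  then have "?s (?s' i) = (?s' \<circ> ?s) i" for i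
    unfolding H(2) by (metis block_reversal_involution[OF \<open>finite H\<close>])
  then have "?s \<circ> ?s' = ?s' \<circ> ?s" by auto
  then have lay': "layered (?s \<circ> ?s')" using lay by simp
  have "\<not> (x \<in> G \<and> x \<notin> G' \<and> Suc x \<in> G')" "\<not> (x \<in> G' \<and> x \<notin> G \<and> Suc x \<in> G)"
    using layered_comp_imp_isolated(1)[OF fin lay] layered_comp_imp_isolated(1)[OF fin(2,1) lay']
    by blast+
  moreover have "\<not> (Suc x \<in> G \<and> Suc x \<notin> G' \<and> x \<in> G')"
    "\<not> (Suc x \<in> G' \<and> Suc x \<notin> G \<and> x \<in> G)"
    using layered_comp_imp_isolated(2)[OF fin lay _ _ refl]
      layered_comp_imp_isolated(2)[OF fin(2,1) lay' _ _ refl]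
    by blast+
  ultimately show ?thesis unfolding compatible_def by blast
qed

section \<open>Counting\<close>

text \<open>Words of length \<open>m\<close>, padded by the blank letter at \<open>0\<close> and
  beyond \<open>m\<close>. Since a blank is compatible with every letter, the padding imposes no
  condition at the ends, and a word ending in a blank is literally a shorter word.\<close>

definition words :: "nat \<Rightarrow> (nat \<Rightarrow> bool \<times> bool) set" where
  "words m = {f. (\<forall>x. x \<notin> {1..m} \<longrightarrow> f x = (False, False)) \<and> (\<forall>x. compatible (f x) (f (Suc x)))}"

lemma words_0: "words 0 = {\<lambda>_. (False, False)}"
  by (auto simp: words_def compatible_def)

lemma words_blank: "{f \<in> words (Suc m). f (Suc m) = (False, False)} = words m"
  by (fastforce simp: words_def le_Suc_eq)

text \<open>Appending a letter overwrites padding only. The inverse blanks the last letter, which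
  never destroys compatibility.\<close>

lemma bij_betw_words_Suc:
  "bij_betw (\<lambda>(f, c). f(Suc m := c)) (SIGMA f:words m. {c. compatible (f m) c}) (words (Suc m))"
proof (rule bij_betw_byWitness[where f' = "\<lambda>f. (f(Suc m := (False, False)), f (Suc m))"])
  have blank: "f(Suc m := (False, False)) = f" if "f \<in> words m" for f
    using that by (auto simp: words_def)
  then show "\<forall>p\<in>(SIGMA f:words m. {c. compatible (f m) c}).
      (\<lambda>f. (f(Suc m := (False, False)), f (Suc m))) ((\<lambda>(f, c). f(Suc m := c)) p) = p"
    by auto
  show "(\<lambda>(f, c). f(Suc m := c)) ` (SIGMA f:words m. {c. compatible (f m) c}) \<subseteq> words (Suc m)"
    by (auto simp: words_def compatible_def split: if_splits)
  show "(\<lambda>f. (f(Suc m := (False, False)), f (Suc m))) ` words (Suc m)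
      \<subseteq> (SIGMA f:words m. {c. compatible (f m) c})"
    by (auto simp: words_def compatible_def split: if_splits)
qed auto

lemma finite_words: "finite (words m)"
proof (induction m)
  case (Suc m)
  then show ?case
    using bij_betw_finite[OF bij_betw_words_Suc[of m]] by simp
qed (simp add: words_0)

lemma card_compatible: "card {d. compatible c d} = (if c = (False, False) then 4 else 2)"
proof (cases "c = (False, False)")
  case True
  then have "{d. compatible c d} = UNIV" by (auto simp: compatible_def)
  then show ?thesis using True by (simp add: card_UNIV_bool flip: UNIV_Times_UNIV)
next
  case False
  then have "{d. compatible c d} = {c, (False, False)}" by (auto simp: compatible_def)
  then show ?thesis using False by simp
qed

text \<open>Every word has two extensions, by a blank or by its last letter repeated, except that a
  final blank allows all four letters and so contributes two more.\<close>

lemma card_words_Suc: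
  "card (words (Suc m)) = 2 * card (words m) + 2 * card {f \<in> words m. f m = (False, False)}"
proof -
  have "card (words (Suc m)) = (\<Sum>f\<in>words m. card {c. compatible (f m) c})"
    using bij_betw_same_card[OF bij_betw_words_Suc[of m]] finite_words[of m] by simp
  also have "\<dots> = (\<Sum>f\<in>words m. 2 + 2 * (if f m = (False, False) then 1 else 0))"
    by (intro sum.cong) (auto simp: card_compatible)
  also have "\<dots> = 2 * card (words m) + 2 * (\<Sum>f\<in>words m. if f m = (False, False) then 1 else 0)"
    by (subst sum.distrib) (simp add: sum_distrib_left)
  also have "(\<Sum>f\<in>words m. if f m = (False, False) then 1 else 0)
      = card {f \<in> words m. f m = (False, False)}"
    using finite_words[of m] by (simp add: sum.If_cases Int_def conj_commute)
  finally show ?thesis .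
qed

section \<open>From words to avoiding pairs, and the recurrence\<close>

lemma avoiders3_iff:
  "(s, s') \<in> avoiders3 n {[2, 3, 1], [3, 1, 2]} \<longleftrightarrow>
     s permutes {1..n} \<and> s' permutes {1..n} \<and> layered s \<and> layered s' \<and> layered (s' \<circ> inv s)"
proof (cases "s permutes {1..n} \<and> s' permutes {1..n}")
  case True
  then have "s' \<circ> inv s permutes {1..n}" by (simp add: permutes_compose permutes_inv)
  then show ?thesis
    using True avoids_iff_layered[of s n] avoids_iff_layered[of s' n]
      avoids_iff_layered[of "s' \<circ> inv s" n]
    unfolding avoiders3_def three_permutations_def avoids_pattern3_def by auto
next
  case False
  then show ?thesis unfolding avoiders3_def three_permutations_def by auto
qed

text \<open>The letter at \<open>x\<close> records whether \<open>x\<close> and \<open>Suc x\<close>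
  share a block in each permutation; only \<open>x\<close> with \<open>1 \<le> x < n\<close> matter,
  whence the length \<open>n - 1\<close>.\<close>

lemma bij_betw_words_avoiders3:
  "bij_betw (\<lambda>f. (block_reversal {x. fst (f x)}, block_reversal {x. snd (f x)}))
     (words (n - 1)) (avoiders3 n {[2, 3, 1], [3, 1, 2]})"
  (is "bij_betw ?F _ _")
proof (rule bij_betw_imageI)
  have sub: "{x. fst (f x)} \<subseteq> {1..<n}" "{x. snd (f x)} \<subseteq> {1..<n}"
    and fin: "finite {x. fst (f x)}" "finite {x. snd (f x)}" if "f \<in> words (n - 1)" for f
  proof -
    have "x \<in> {1..<n}" if "f x \<noteq> (False, False)" for x
    proof -
      have "x \<in> {1..n - 1}" using \<open>f \<in> _\<close> that unfolding words_def by blast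
      then show ?thesis by auto
    qed
    then show sub: "{x. fst (f x)} \<subseteq> {1..<n}" "{x. snd (f x)} \<subseteq> {1..<n}" by force+
    show "finite {x. fst (f x)}" "finite {x. snd (f x)}"
      by (rule finite_subset[OF sub(1)] finite_subset[OF sub(2)], simp)+
  qed
  show "inj_on ?F (words (n - 1))"
  proof (rule inj_onI)
    fix f g
    assume fg: "f \<in> words (n - 1)" "g \<in> words (n - 1)" and "?F f = ?F g"
    then have eq: "block_reversal {x. fst (f x)} = block_reversal {x. fst (g x)}"
      "block_reversal {x. snd (f x)} = block_reversal {x. snd (g x)}" by auto
    have "{x. fst (f x)} = {x. fst (g x)}" "{x. snd (f x)} = {x. snd (g x)}"
      by (intro set_eqI, simp only: mem_iff_block_reversal_step[OF fin(1)[OF fg(1)]]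
          mem_iff_block_reversal_step[OF fin(1)[OF fg(2)]]
          mem_iff_block_reversal_step[OF fin(2)[OF fg(1)]]
          mem_iff_block_reversal_step[OF fin(2)[OF fg(2)]] eq)+
    then show "f = g" by (auto intro!: ext prod_eqI)
  qed
  show "?F ` words (n - 1) = avoiders3 n {[2, 3, 1], [3, 1, 2]}"
  proof (intro set_eqI iffI)
    fix p
    assume "p \<in> ?F ` words (n - 1)"
    then obtain f where f: "f \<in> words (n - 1)" "p = ?F f" by blast
    have "layered (block_reversal {x. snd (f x)} \<circ> block_reversal {x. fst (f x)})"
      using f(1) by (intro compatible_imp_layered_comp fin) (auto simp: words_def)
    then show "p \<in> avoiders3 n {[2, 3, 1], [3, 1, 2]}"
      unfolding f(2) avoiders3_iff using fin[OF f(1)] sub[OF f(1), THEN block_reversal_permutes]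
      by (simp add: layered_block_reversal inv_block_reversal)
  next
    fix p
    assume "p \<in> avoiders3 n {[2, 3, 1], [3, 1, 2]}"
    then obtain s s' where p: "p = (s, s')"
      and s: "s permutes {1..n}" "layered s" and s': "s' permutes {1..n}" "layered s'"
      and lay: "layered (s' \<circ> inv s)"
      by (metis avoiders3_iff surj_pair)
    obtain G where G: "G \<subseteq> {1..<n}" "s = block_reversal G"
      using s layered_imp_block_reversal by blast
    obtain G' where G': "G' \<subseteq> {1..<n}" "s' = block_reversal G'"
      using s' layered_imp_block_reversal by blast
    have "finite G" using G(1) finite_subset by blast
    then have "layered (block_reversal G' \<circ> block_reversal G)"
      using lay G G' by (simp add: inv_block_reversal)
    then have word: "(\<lambda>x. (x \<in> G, x \<in> G')) \<in> words (n - 1)"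
      using layered_comp_imp_compatible[OF G(1) G'(1)] G(1) G'(1) unfolding words_def by auto
    show "p \<in> ?F ` words (n - 1)"
      by (rule image_eqI[OF _ word]) (use p G G' in simp)
  qed
qed

theorem theorem3p3:
  fixes a :: "nat \<Rightarrow> nat"
  assumes a_def: "\<And>n. n \<ge> 1 \<Longrightarrow> a n = card (avoiders3 n {[2,3,1], [3,1,2]})"
  shows "a 1 = 1 \<and> a 2 = 4 \<and> (\<forall>n\<ge>2. a (n + 1) = 2 * a n + 2 * a (n - 1))"
proof -
  have a_Suc: "a (Suc m) = card (words m)" for m
    using a_def[of "Suc m"] bij_betw_same_card[OF bij_betw_words_avoiders3[of "Suc m"]] by simp
  \<comment> \<open>By \<open>words_blank\<close> the words ending in a blank are those one letter
    shorter, which yields the second term.\<close>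
  have rec: "a (Suc (Suc (Suc m))) = 2 * a (Suc (Suc m)) + 2 * a (Suc m)" for m
    unfolding a_Suc card_words_Suc[of "Suc m"] words_blank ..
  have "a 1 = 1" using a_Suc[of 0] by (simp add: words_0)
  moreover have "a 2 = 4"
  proof -
    \<comment> \<open>The letter at \<open>0\<close> is padding, so the empty word counts as ending
      in a blank and has four extensions.\<close>
    have "{f \<in> words 0. f 0 = (False, False)} = words 0" by (auto simp: words_0)
    then show ?thesis
      using a_Suc[of 1] card_words_Suc[of 0] by (simp add: words_0 numeral_2_eq_2)
  qed
  moreover have "a (n + 1) = 2 * a n + 2 * a (n - 1)" if "n \<ge> 2" for n
    using rec[of "n - 2"] that by (simp add: numeral_2_eq_2 Suc_diff_Suc)
  ultimately show ?thesis by blast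
qed

end
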